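(* Let $n_v\ge 1$, $N\ge 1$, let $i_1,\dots,i_{n_v}$ be integers modulo $N$ with $i_1=0$, let $P_j=x^{i_j}$ for $j\in\{1,\dots,n_v\}$, and let $$H_2=\begin{bmatrix} I & I&\cdots & I\\ P_1& P_2&\cdots &P_{n_v}\end{bmatrix},\qquad C_{21}=\sum_{j=1}^{n_v}P_j$$ (sum over $\mathbb Z$). Then: 1) $\mathrm{girth}(H_2)>4$ if and only if $\mathrm{girth}(C_{21})>2$, and this holds if and only if the set $\{i_j \mid j\in\{1,\dots,n_v\}\}$ is of maximal size. 2) $\mathrm{girth}(H_2)>8$ if and only if the set $\{i_j-i_l\mid j,l\in\{1,\dots,n_v\},\ j\ne l\}$ is of maximal size.
   Context: $x^r$ denotes the $N\times N$ circulant permutation matrix obtained from the identity by cyclically shifting to the left by $r$ positions; exponents are taken modulo $N$, so $x^ax^b=x^{a+b}$ and $(x^a)^{\mathsf T}=x^{-a}$. An indexed set is "of maximal size" if all its listed values, for different indices, are distinct modulo $N$ (e.g. the set in 2) has exactly $n_v(n_v-1)$ elements in $\mathbb Z/N\mathbb Z$). The Tanner graph of a matrix with non-negative integer entries is the bipartite (multi)graph with one check node per row, one variable node per column, and as many edges between check node $a$ and variable node $b$ as the $(a,b)$ entry. $\mathrm{girth}(M)$ is the length of a shortest cycle in the Tanner graph of $M$ ($+\infty$ if there is none); a graph with multiple edges is said to have girth $2$. *)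

theory Defs
  imports
    "Jordan_Normal_Form.Matrix"
    "HOL-Library.Extended_Nat"
    "HOL-Number_Theory.Cong"
begin

(* Undirected multigraphs: an edge e joins the elements of ends G e
   (a singleton for a loop). *)
record ('v, 'e) multigraph =
  verts :: "'v set"
  edges :: "'e set"
  ends :: "'e \<Rightarrow> 'v set"

(* The edge es ! k joins vs ! k to its cyclic successor.  Requiring the edges to
   be distinct matters only in length 2: the two edges must be parallel edges,
   not one edge traversed back and forth. *)
definition is_cycle :: "('v, 'e) multigraph \<Rightarrow> 'v list \<Rightarrow> 'e list \<Rightarrow> bool" where
  "is_cycle G vs es \<longleftrightarrow>
     es \<noteq> [] \<and> length vs = length es \<and>
     distinct vs \<and> distinct es \<and>
     set vs \<subseteq> verts G \<and> set es \<subseteq> edges G \<and>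
     (\<forall>k < length es. ends G (es ! k) = {vs ! k, vs ! ((k + 1) mod length es)})"

(* In enat the infimum of the empty set is \<infinity>. *)
definition graph_girth :: "('v, 'e) multigraph \<Rightarrow> enat" where
  "graph_girth G = Inf {enat (length es) | vs es. is_cycle G vs es}"

datatype tanner_node = Check nat | Variable nat

(* The triple (a, b, k) is the k-th of the M $$ (a, b) parallel edges between
   check node a and variable node b. *)
definition tanner_graph :: "nat mat \<Rightarrow> (tanner_node, nat \<times> nat \<times> nat) multigraph" where
  "tanner_graph M =
     \<lparr> verts = Check ` {..<dim_row M} \<union> Variable ` {..<dim_col M},
       edges = {(a, b, k). a < dim_row M \<and> b < dim_col M \<and> k < M $$ (a, b)},
       ends = (\<lambda>(a, b, k). {Check a, Variable b}) \<rparr>"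

definition girth :: "nat mat \<Rightarrow> enat" where
  "girth M = graph_girth (tanner_graph M)"

(* The circulant x^r: shifting the identity to the left by r moves the entry 1
   of row a from column a to column a - r (mod N). *)
definition circ :: "nat \<Rightarrow> int \<Rightarrow> nat mat" where
  "circ N r = mat N N (\<lambda>(a, b). if [int b = int a - r] (mod int N) then 1 else 0)"

(* The matrix with p block rows and q block columns whose N x N blocks are B s t,
   with s < p and t < q counted from 0. *)
definition block_mat :: "nat \<Rightarrow> nat \<Rightarrow> nat \<Rightarrow> (nat \<Rightarrow> nat \<Rightarrow> nat mat) \<Rightarrow> nat mat" where
  "block_mat N p q B =
     mat (p * N) (q * N) (\<lambda>(a, b). B (a div N) (b div N) $$ (a mod N, b mod N))"

(* P is indexed from 1, block columns from 0. *)
definition H2 :: "nat \<Rightarrow> nat \<Rightarrow> (nat \<Rightarrow> nat mat) \<Rightarrow> nat mat" where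
  "H2 N nv P = block_mat N 2 nv (\<lambda>s t. if s = 0 then 1\<^sub>m N else P (t + 1))"

(* Entrywise, because matrices of varying dimension do not form a
   comm_monoid_add. *)
definition C21 :: "nat \<Rightarrow> nat \<Rightarrow> (nat \<Rightarrow> nat mat) \<Rightarrow> nat mat" where
  "C21 N nv P = mat N N (\<lambda>(a, b). \<Sum>j\<in>{1..nv}. P j $$ (a, b))"

(* The indexed set {f j | j \<in> J} of integers modulo N, given by representatives,
   is of maximal size: different indices give values distinct modulo N. *)
definition maximal_size :: "nat \<Rightarrow> 'j set \<Rightarrow> ('j \<Rightarrow> int) \<Rightarrow> bool" where
  "maximal_size N J f \<longleftrightarrow>
     (\<forall>j\<in>J. \<forall>l\<in>J. j \<noteq> l \<longrightarrow> \<not> [f j = f l] (mod int N))"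

end

theory Submission imports Defs
begin

text \<open>
  Every column of \<open>H\<^sub>2\<close> meets exactly one upper and one lower check node, so a cycle runs
  alternately through upper and lower checks and its length is a multiple of 4.  Passing from an
  upper check through block column \<open>j\<close> adds \<open>i\<^sub>j\<close> to its position modulo \<open>N\<close>, coming back through
  block column \<open>l\<close> subtracts \<open>i\<^sub>l\<close>, and consecutive block columns differ.  Hence a 4-cycle is a
  congruence \<open>i\<^sub>j = i\<^sub>l\<close> with \<open>j \<noteq> l\<close>, and an 8-cycle yields \<open>i\<^sub>j - i\<^sub>l = i\<^sub>p - i\<^sub>q\<close> with
  \<open>(j, l) \<noteq> (p, q)\<close>.  Conversely, such a coincidence of differences closes up to an 8-cycle, unless
  two of its checks collide, in which case there is already a 4-cycle.
\<close>

section \<open>Girth bounds and cycles in Tanner graphs\<close>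

lemma graph_girth_greater_iff:
  "graph_girth G > enat n \<longleftrightarrow> (\<forall>vs es. is_cycle G vs es \<longrightarrow> length es > n)"
proof -
  \<comment> \<open>A strict bound need not pass to an infimum; a bound \<open>\<le>\<close> does,
    and it can be tested on each cycle separately.\<close>
  have "graph_girth G > enat n \<longleftrightarrow> enat (Suc n) \<le> graph_girth G"
    by (metis Suc_ile_eq)
  also have "\<dots> \<longleftrightarrow> (\<forall>vs es. is_cycle G vs es \<longrightarrow> length es > n)"
    unfolding graph_girth_def le_Inf_iff by (fastforce simp: Suc_le_eq)
  finally show ?thesis .
qed

lemma tanner_edge_iff:
  "(a, b, k) \<in> edges (tanner_graph M) \<longleftrightarrow> a < dim_row M \<and> b < dim_col M \<and> k < M $$ (a, b)"
  by (simp add: tanner_graph_def)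

lemma tanner_ends: "ends (tanner_graph M) (a, b, k) = {Check a, Variable b}"
  by (simp add: tanner_graph_def)

lemma tanner_vert_iff:
  "Check a \<in> verts (tanner_graph M) \<longleftrightarrow> a < dim_row M"
  "Variable b \<in> verts (tanner_graph M) \<longleftrightarrow> b < dim_col M"
  by (auto simp: tanner_graph_def)

text \<open>A cycle of length 1 would be a loop, but every edge joins nodes of two different
  kinds.\<close>

lemma tanner_cycle_length_ge_2:
  assumes "is_cycle (tanner_graph M) vs es"
  shows "length es \<ge> 2"
proof (rule ccontr)
  assume "\<not> length es \<ge> 2"
  then have "length es < 2" by simp
  moreover have "es \<noteq> []" using assms by (simp add: is_cycle_def)
  ultimately have "length es = 1" by (cases es) (auto simp: not_le)
  with assms have "ends (tanner_graph M) (es ! 0) = {vs ! 0}"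
    by (auto simp: is_cycle_def)
  then show False
    by (cases "es ! 0") (simp add: tanner_ends, metis tanner_node.distinct(1))
qed

text \<open>A 2-cycle is a pair of parallel edges, hence an entry of at least 2.\<close>

lemma girth_greater_2_iff:
  "girth M > 2 \<longleftrightarrow> (\<forall>a < dim_row M. \<forall>b < dim_col M. M $$ (a, b) \<le> 1)"
proof
  assume girth: "girth M > 2"
  show "\<forall>a < dim_row M. \<forall>b < dim_col M. M $$ (a, b) \<le> 1"
  proof (intro allI impI, rule ccontr)
    fix a b assume ab: "a < dim_row M" "b < dim_col M" "\<not> M $$ (a, b) \<le> 1"
    then have "is_cycle (tanner_graph M) [Check a, Variable b] [(a, b, 0), (a, b, 1)]"
      unfolding is_cycle_def
      by (auto simp: tanner_edge_iff tanner_ends tanner_vert_iff less_Suc_eq numeral_2_eq_2)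
    with girth show False
      using graph_girth_greater_iff[of 2 "tanner_graph M"]
      by (fastforce simp: girth_def numeral_eq_enat)
  qed
next
  assume small: "\<forall>a < dim_row M. \<forall>b < dim_col M. M $$ (a, b) \<le> 1"
  have "length es > 2" if cyc: "is_cycle (tanner_graph M) vs es" for vs es
  proof (rule ccontr)
    assume "\<not> length es > 2"
    with tanner_cycle_length_ge_2[OF cyc] have len: "length es = 2" by simp
    obtain a b k a' b' k' where e: "es ! 0 = (a, b, k)" "es ! 1 = (a', b', k')"
      by (metis prod_cases3)
    have "ends (tanner_graph M) (es ! 0) = {vs ! 0, vs ! 1}"
      "ends (tanner_graph M) (es ! 1) = {vs ! 1, vs ! 0}"
      using cyc len by (auto simp: is_cycle_def)
    then have "{Check a, Variable b} = {Check a', Variable b'}"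
      unfolding e tanner_ends by auto
    then have same: "a' = a" "b' = b" by (auto simp: doubleton_eq_iff)
    have "es ! 0 \<in> edges (tanner_graph M)" "es ! 1 \<in> edges (tanner_graph M)"
      using cyc len by (auto simp: is_cycle_def)
    \<comment> \<open>An entry of at most 1 leaves only the number 0 for an edge, so the two edges
      of the cycle coincide.\<close>
    with same small have "k = 0" "k' = 0"
      unfolding e tanner_edge_iff by fastforce+
    with same e have "es ! 0 = es ! 1" by simp
    with cyc len show False
      by (simp add: is_cycle_def nth_eq_iff_index_eq)
  qed
  then show "girth M > 2"
    using graph_girth_greater_iff[of 2 "tanner_graph M"] by (simp add: girth_def numeral_eq_enat)
qed

text \<open>Unrolling the cycle into periodic sequences on all of \<open>nat\<close> lets later
  arguments start at any node without wrapping indices. That consecutive edges differ is the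
  non-backtracking property on which these arguments rest.\<close>

lemma tanner_cycle_walk:
  assumes cyc: "is_cycle (tanner_graph M) vs es"
  obtains v e where
    "\<And>k. v (k + length es) = v k" "\<And>k. e (k + length es) = e k"
    "\<And>k. e k \<in> edges (tanner_graph M)"
    "\<And>k. ends (tanner_graph M) (e k) = {v k, v (Suc k)}"
    "\<And>k. e k \<noteq> e (Suc k)"
proof -
  let ?n = "length es"
  have n: "?n \<ge> 2" using tanner_cycle_length_ge_2[OF cyc] .
  then have lt: "k mod ?n < ?n" for k by (intro mod_less_divisor) linarith
  show thesis
  proof (rule that[of "\<lambda>k. vs ! (k mod ?n)" "\<lambda>k. es ! (k mod ?n)"])
    fix k
    show "es ! (k mod ?n) \<in> edges (tanner_graph M)"
      using cyc lt[of k] by (auto simp: is_cycle_def)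
    show "ends (tanner_graph M) (es ! (k mod ?n)) = {vs ! (k mod ?n), vs ! (Suc k mod ?n)}"
      using cyc lt[of k] by (auto simp: is_cycle_def mod_Suc_eq)
    have "k mod ?n \<noteq> Suc k mod ?n"
      using n by (auto simp: mod_Suc)
    then show "es ! (k mod ?n) \<noteq> es ! (Suc k mod ?n)"
      using cyc lt[of k] lt[of "Suc k"] by (simp add: is_cycle_def nth_eq_iff_index_eq)
  qed simp_all
qed

context
  fixes nv N :: nat and i :: "nat \<Rightarrow> int" and P :: "nat \<Rightarrow> nat mat"
  assumes N: "N \<ge> 1"
    and P: "\<And>j. j \<in> {1..nv} \<Longrightarrow> P j = circ N (i j)"
begin

section \<open>Multiplicities of the entries of \<open>C21\<close>\<close>

lemma C21_dim: "dim_row (C21 N nv P) = N" "dim_col (C21 N nv P) = N"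
  by (simp_all add: C21_def)

lemma C21_entry:
  assumes "a < N" "b < N"
  shows "C21 N nv P $$ (a, b) = card {j \<in> {1..nv}. [int b = int a - i j] (mod int N)}"
proof -
  have "C21 N nv P $$ (a, b) = (\<Sum>j\<in>{1..nv}. P j $$ (a, b))"
    using assms by (simp add: C21_def)
  also have "\<dots> = (\<Sum>j\<in>{1..nv}. if [int b = int a - i j] (mod int N) then 1 else 0)"
    using assms by (intro sum.cong) (auto simp: P circ_def)
  also have "\<dots> = card {j \<in> {1..nv}. [int b = int a - i j] (mod int N)}"
    by (simp add: sum.If_cases Int_def)
  finally show ?thesis .
qed

text \<open>Entry \<open>(a, b)\<close> counts the shifts congruent to \<open>a - b\<close>, so it
  exceeds 1 exactly when two indices have this shift in common.\<close>

lemma C21_girth: "girth (C21 N nv P) > 2 \<longleftrightarrow> maximal_size N {1..nv} i"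
proof -
  have "girth (C21 N nv P) > 2 \<longleftrightarrow>
      (\<forall>a<N. \<forall>b<N. card {j \<in> {1..nv}. [int b = int a - i j] (mod int N)} \<le> 1)"
    unfolding girth_greater_2_iff C21_dim by (metis C21_entry)
  also have "\<dots> \<longleftrightarrow> maximal_size N {1..nv} i"
  proof
    assume card: "\<forall>a<N. \<forall>b<N. card {j \<in> {1..nv}. [int b = int a - i j] (mod int N)} \<le> 1"
    show "maximal_size N {1..nv} i"
      unfolding maximal_size_def
    proof (intro ballI impI notI)
      fix j l assume jl: "j \<in> {1..nv}" "l \<in> {1..nv}" "j \<noteq> l" "[i j = i l] (mod int N)"
      \<comment> \<open>Row 0 already shows the coincidence: \<open>b\<close> is the column in which
        \<open>circ N (i j)\<close> and \<open>circ N (i l)\<close> both have their 1 in that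
        row.\<close>
      define b where "b = nat ((- i j) mod int N)"
      have b: "int b = (- i j) mod int N" "b < N"
        using N by (simp_all add: b_def nat_less_iff)
      have "[int b = int 0 - i j] (mod int N)" using b by (simp add: cong_def)
      moreover from this have "[int b = int 0 - i l] (mod int N)"
        using jl(4) by (metis cong_diff cong_refl cong_trans)
      ultimately have "{j, l} \<subseteq> {j \<in> {1..nv}. [int b = int 0 - i j] (mod int N)}"
        using jl by blast
      then have "card {j, l} \<le> card {j \<in> {1..nv}. [int b = int 0 - i j] (mod int N)}"
        by (intro card_mono) auto
      with card b(2) N jl(3) show False by fastforce
    qed
  next
    assume max: "maximal_size N {1..nv} i"
    show "\<forall>a<N. \<forall>b<N. card {j \<in> {1..nv}. [int b = int a - i j] (mod int N)} \<le> 1"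
    proof (intro allI impI)
      fix a b
      have "j = l" if "j \<in> {1..nv}" "l \<in> {1..nv}"
        "[int b = int a - i j] (mod int N)" "[int b = int a - i l] (mod int N)" for j l
      proof -
        have "[int a - i j = int a - i l] (mod int N)"
          using that(3,4) by (metis cong_sym cong_trans)
        then have "[i j = i l] (mod int N)"
          using cong_diff[OF cong_refl[of "int a"]] by fastforce
        with that(1,2) max show ?thesis unfolding maximal_size_def by blast
      qed
      then show "card {j \<in> {1..nv}. [int b = int a - i j] (mod int N)} \<le> 1"
        by (auto simp: card_le_Suc0_iff_eq)
    qed
  qed
  finally show ?thesis .
qed

section \<open>Edges of the Tanner graph of \<open>H2\<close>\<close>

lemma H2_vert_iff:
  "Check a \<in> verts (tanner_graph (H2 N nv P)) \<longleftrightarrow> a < 2 * N"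
  "Variable c \<in> verts (tanner_graph (H2 N nv P)) \<longleftrightarrow> c < nv * N"
  by (simp_all add: tanner_vert_iff H2_def block_mat_def)

text \<open>
  The lower checks carry the numbers \<open>N, \<dots>, 2 N - 1\<close>; working modulo \<open>N\<close> makes the offset
  disappear.
\<close>

lemma H2_edge_iff:
  "(a, c, k) \<in> edges (tanner_graph (H2 N nv P)) \<longleftrightarrow>
     k = 0 \<and> c < nv * N \<and>
     (a < N \<and> c mod N = a \<or>
      N \<le> a \<and> a < 2 * N \<and> [int a = int c + i (c div N + 1)] (mod int N))"
proof (cases "a < 2 * N \<and> c < nv * N")
  case False
  then show ?thesis by (auto simp: tanner_edge_iff H2_def block_mat_def)
next
  case True
  have mods: "c mod N < N" "a mod N < N" using N by auto
  have "c div N < nv" using True N by (simp add: less_mult_imp_div_less)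
  then have blk: "P (Suc (c div N)) = circ N (i (Suc (c div N)))" by (intro P) auto
  show ?thesis
  proof (cases "a < N")
    case True': True
    then show ?thesis using True mods
      by (auto simp: tanner_edge_iff H2_def block_mat_def)
  next
    case False
    then have "a div N = 1"
      using True N by (metis div_nat_eqI mult.commute mult_1_right not_less Suc_1)
    \<comment> \<open>The position of the 1 in a row of the circulant is solved for the check
      instead of the column; the congruence absorbs both remainders.\<close>
    moreover have "[int (c mod N) = int (a mod N) - x] (mod int N) \<longleftrightarrow>
        [int a = int c + x] (mod int N)" for x
    proof -
      have "[int (c mod N) = int (a mod N) - x] (mod int N) \<longleftrightarrow> [int c = int a - x] (mod int N)"
        by (simp add: cong_def zmod_int mod_diff_left_eq)
      also have "\<dots> \<longleftrightarrow> [int a = int c + x] (mod int N)"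
        by (simp add: cong_iff_dvd_diff dvd_diff_commute algebra_simps)
      finally show ?thesis .
    qed
    ultimately show ?thesis using True False mods blk
      by (auto simp: tanner_edge_iff H2_def block_mat_def circ_def)
  qed
qed

section \<open>Non-backtracking walks in the Tanner graph of \<open>H2\<close>\<close>

context
  fixes v :: "nat \<Rightarrow> tanner_node" and e :: "nat \<Rightarrow> nat \<times> nat \<times> nat" and blk :: "nat \<Rightarrow> nat"
  assumes edge: "\<And>k. e k \<in> edges (tanner_graph (H2 N nv P))"
    and ends: "\<And>k. ends (tanner_graph (H2 N nv P)) (e k) = {v k, v (Suc k)}"
    and neq: "\<And>k. e k \<noteq> e (Suc k)"
  \<comment> \<open>The middle component of an edge is its column; the added 1 matches the indexing
    of \<open>i\<close> and \<open>P\<close> from 1.\<close>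
  defines "blk \<equiv> \<lambda>k. fst (snd (e k)) div N + 1"
begin

lemma blk_range: "blk k \<in> {1..nv}"
proof -
  obtain a c m where e: "e k = (a, c, m)" by (metis prod_cases3)
  have "c < nv * N" using edge[of k] unfolding e H2_edge_iff by simp
  then have "c div N < nv" by (simp add: less_mult_imp_div_less)
  then show ?thesis by (simp add: blk_def e)
qed

text \<open>The entries of \<open>H2\<close> are 0 or 1, so two different edges at one variable node
  must lead to different checks.\<close>

lemma step_through_variable:
  assumes "v k = Check t"
  obtains b c where "e k = (t, c, 0)" "e (Suc k) = (b, c, 0)" "v (Suc (Suc k)) = Check b" "b \<noteq> t"
proof -
  obtain a c m where e0: "e k = (a, c, m)" by (metis prod_cases3)
  obtain b d m' where e1: "e (Suc k) = (b, d, m')" by (metis prod_cases3)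
  have m: "m = 0" "m' = 0"
    using edge[of k] edge[of "Suc k"] unfolding e0 e1 H2_edge_iff by auto
  have "{Check a, Variable c} = {Check t, v (Suc k)}"
    using ends[of k] unfolding e0 tanner_ends assms .
  then have a: "a = t" "v (Suc k) = Variable c" by (auto simp: doubleton_eq_iff)
  have "{Check b, Variable d} = {Variable c, v (Suc (Suc k))}"
    using ends[of "Suc k"] unfolding e1 tanner_ends a .
  then have b: "d = c" "v (Suc (Suc k)) = Check b" by (auto simp: doubleton_eq_iff)
  have "b \<noteq> t" using neq[of k] e0 e1 m a b by auto
  with that e0 e1 m a b show thesis by blast
qed

text \<open>All blocks are permutation matrices, so a check has just one edge into each block
  column.\<close>

lemma blk_changes_at_check:
  assumes "v (Suc k) = Check b"
  shows "blk k \<noteq> blk (Suc k)"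
proof
  assume same: "blk k = blk (Suc k)"
  obtain a c m where e0: "e k = (a, c, m)" by (metis prod_cases3)
  obtain a' c' m' where e1: "e (Suc k) = (a', c', m')" by (metis prod_cases3)
  have eqs: "a = b" "a' = b"
    using ends[of k] ends[of "Suc k"] unfolding e0 e1 tanner_ends assms
    by (auto simp: doubleton_eq_iff)
  have div: "c div N = c' div N" using same by (simp add: blk_def e0 e1)
  \<comment> \<open>Within a block column the check determines the remainder: directly for an upper
    check, after cancelling the common shift for a lower one.\<close>
  have "c mod N = c' mod N"
  proof (cases "b < N")
    case True
    then show ?thesis
      using edge[of k] edge[of "Suc k"] unfolding e0 e1 H2_edge_iff eqs by auto
  next
    case False
    then have "[int b = int c + i (c div N + 1)] (mod int N)"
      "[int b = int c' + i (c div N + 1)] (mod int N)"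
      using edge[of k] edge[of "Suc k"] unfolding e0 e1 H2_edge_iff eqs div by auto
    then have "[int c + i (c div N + 1) = int c' + i (c div N + 1)] (mod int N)"
      by (metis cong_sym cong_trans)
    then have "[int c = int c'] (mod int N)" by (simp add: cong_add_rcancel)
    then have "[c = c'] (mod N)" by (simp only: cong_int_iff)
    then show ?thesis by (simp add: cong_def)
  qed
  with div have "c = c'" by (metis div_mult_mod_eq)
  then show False
    using neq[of k] edge[of k] edge[of "Suc k"] e0 e1 eqs by (auto simp: H2_edge_iff)
qed

text \<open>A column meets only one upper check, the one given by its remainder, so the other end is
  a lower check, displaced by the shift of the block. The block stays the same through the variable
  and changes at the next check.\<close>

lemma step_down:
  assumes "v k = Check t" "t < N"
  obtains b where "v (k + 2) = Check b" "N \<le> b" "blk (k + 1) = blk k" "blk (k + 2) \<noteq> blk k"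
    "[int b = int t + i (blk k)] (mod int N)"
proof -
  obtain b c where s: "e k = (t, c, 0)" "e (Suc k) = (b, c, 0)" "v (Suc (Suc k)) = Check b" "b \<noteq> t"
    using step_through_variable[OF assms(1)] .
  have t: "c mod N = t" using edge[of k] assms(2) unfolding s H2_edge_iff by auto
  have b: "N \<le> b" "[int b = int c + i (c div N + 1)] (mod int N)"
    using edge[of "Suc k"] s(4) t unfolding s H2_edge_iff by auto
  have "[int c = int t] (mod int N)" unfolding t[symmetric] by (simp add: cong_def zmod_int)
  then have "[int c + i (c div N + 1) = int t + i (c div N + 1)] (mod int N)"
    by (simp add: cong_add_rcancel)
  with b have "[int b = int t + i (blk k)] (mod int N)"
    unfolding blk_def s by (auto intro: cong_trans)
  moreover have "blk (Suc k) = blk k" by (simp add: blk_def s)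
  moreover have "blk (Suc k) \<noteq> blk (Suc (Suc k))" using blk_changes_at_check[OF s(3)] .
  ultimately show thesis using that[of b] s b by simp
qed

lemma step_up:
  assumes "v k = Check b" "N \<le> b"
  obtains t where "v (k + 2) = Check t" "t < N" "blk (k + 1) = blk k" "blk (k + 2) \<noteq> blk k"
    "[int b = int t + i (blk k)] (mod int N)"
proof -
  obtain t c where s: "e k = (b, c, 0)" "e (Suc k) = (t, c, 0)" "v (Suc (Suc k)) = Check t" "t \<noteq> b"
    using step_through_variable[OF assms(1)] .
  have b: "b < 2 * N" "[int b = int c + i (c div N + 1)] (mod int N)"
    using edge[of k] assms(2) unfolding s H2_edge_iff by auto
  \<comment> \<open>Two lower checks on the same column would be congruent modulo \<open>N\<close>,
    while the range from \<open>N\<close> to \<open>2 * N - 1\<close> contains each residue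
    once.\<close>
  have "t < N"
  proof (rule ccontr)
    assume "\<not> t < N"
    then have t: "N \<le> t" "t < 2 * N" "[int t = int c + i (c div N + 1)] (mod int N)"
      using edge[of "Suc k"] unfolding s H2_edge_iff by auto
    then have "[int t = int b] (mod int N)" using b by (metis cong_sym cong_trans)
    then have "[t = b] (mod N)" by (simp add: cong_int_iff)
    then have "t mod N = b mod N" by (simp add: cong_def)
    moreover have "t mod N = t - N" "b mod N = b - N"
      using t b assms(2) by (simp_all add: mod_if)
    ultimately show False using t assms(2) s(4) by linarith
  qed
  then have t: "t < N" "c mod N = t" using edge[of "Suc k"] unfolding s H2_edge_iff by auto
  have "[int c = int t] (mod int N)" unfolding t(2)[symmetric] by (simp add: cong_def zmod_int)
  then have "[int c + i (c div N + 1) = int t + i (c div N + 1)] (mod int N)"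
    by (simp add: cong_add_rcancel)
  with b have "[int b = int t + i (blk k)] (mod int N)"
    unfolding blk_def s by (auto intro: cong_trans)
  moreover have "blk (Suc k) = blk k" by (simp add: blk_def s)
  moreover have "blk (Suc k) \<noteq> blk (Suc (Suc k))" using blk_changes_at_check[OF s(3)] .
  ultimately show thesis using that[of t] s t by simp
qed

text \<open>Going down and up again eliminates the lower check: the position changes by the
  difference of the two shifts used.\<close>

lemma double_step:
  assumes "v k = Check t" "t < N"
  obtains t' where "v (k + 4) = Check t'" "t' < N" "blk (k + 2) \<noteq> blk k" "blk (k + 4) \<noteq> blk (k + 2)"
    "[int t + i (blk k) = int t' + i (blk (k + 2))] (mod int N)"
proof -
  obtain b where b: "v (k + 2) = Check b" "N \<le> b" "blk (k + 2) \<noteq> blk k"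
    "[int b = int t + i (blk k)] (mod int N)"
    using step_down[OF assms] by metis
  obtain t' where t': "v (k + 2 + 2) = Check t'" "t' < N" "blk (k + 2 + 2) \<noteq> blk (k + 2)"
    "[int b = int t' + i (blk (k + 2))] (mod int N)"
    using step_up[OF b(1,2)] by metis
  have "[int t + i (blk k) = int t' + i (blk (k + 2))] (mod int N)"
    using b(4) t'(4) by (metis cong_sym cong_trans)
  with that[of t'] b t' show thesis by (simp add: numeral_eq_Suc)
qed

text \<open>Every edge has a check as an end; if that check is a lower one, the walk is at an upper
  check two steps later.\<close>

lemma reaches_upper_check: obtains k t where "v k = Check t" "t < N"
proof -
  obtain a c m where "e 0 = (a, c, m)" by (metis prod_cases3)
  then have "{Check a, Variable c} = {v 0, v (Suc 0)}"
    using ends[of 0] by (simp add: tanner_ends)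
  then obtain k a where a: "v k = Check a"
    by (metis doubleton_eq_iff)
  show thesis
  proof (cases "a < N")
    case True
    then show thesis using that a by blast
  next
    case False
    then show thesis using step_up[OF a] that by (metis not_less)
  qed
qed

lemma every_fourth_upper:
  assumes "v k = Check t" "t < N"
  shows "\<exists>t<N. v (k + 4 * m) = Check t"
proof (induction m)
  case 0
  then show ?case using assms by auto
next
  case (Suc m)
  then obtain t' where "t' < N" "v (k + 4 * m) = Check t'" by blast
  then obtain t'' where "v (k + 4 * m + 4) = Check t''" "t'' < N" using double_step by metis
  then show ?case by (auto simp: algebra_simps)
qed

text \<open>From an upper check the kinds of nodes repeat as upper check, variable, lower check,
  variable.\<close>

lemma period_multiple_of_4:
  assumes "v k = Check t" "t < N" "v (k + n) = v k"
  shows "4 dvd n"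
proof -
  have n: "n = 4 * (n div 4) + n mod 4" by simp
  obtain t' where t': "t' < N" "v (k + 4 * (n div 4)) = Check t'"
    using every_fourth_upper[OF assms(1,2)] by blast
  \<comment> \<open>After all full rounds, the remaining \<open>n mod 4\<close> steps lead from the
    upper check at \<open>k'\<close> to the upper check \<open>t\<close>. Odd remainders would make
    two checks adjacent, and remainder 2 ends at a lower check.\<close>
  define k' where "k' = k + 4 * (n div 4)"
  have v: "v (k' + n mod 4) = Check t"
    using assms n by (simp add: k'_def add.assoc)
  have k': "v k' = Check t'" using t' k'_def by simp
  obtain b where b: "v (k' + 2) = Check b" "N \<le> b" using step_down[OF k' t'(1)] by metis
  have adj: "v (Suc m) \<noteq> Check y" if "v m = Check x" for m x y
    using ends[of m] that by (cases "e m") (auto simp: tanner_ends doubleton_eq_iff)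
  have "n mod 4 = 0 \<or> n mod 4 = 1 \<or> n mod 4 = 2 \<or> n mod 4 = 3" by linarith
  then have "n mod 4 = 0"
  proof (elim disjE)
    assume "n mod 4 = 1"
    with v adj[OF k'] show ?thesis by simp
  next
    assume "n mod 4 = 2"
    with v b assms(2) show ?thesis by simp
  next
    assume "n mod 4 = 3"
    then have "k' + n mod 4 = Suc (k' + 2)" by simp
    with v adj[OF b(1)] show ?thesis by metis
  qed
  then show ?thesis by (simp add: mod_eq_0_iff_dvd)
qed

end

text \<open>The length is a positive multiple of 4, so the cycle consists of one or two double
  steps. For length 8 the blocks met in order are \<open>j\<close>, \<open>l\<close>,
  \<open>q\<close>, \<open>p\<close>, and the four inequalities say that cyclic neighbours
  differ.\<close>

lemma H2_short_cycle:
  assumes cyc: "is_cycle (tanner_graph (H2 N nv P)) vs es" and le: "length es \<le> 8"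
  shows "length es = 4 \<and> (\<exists>j\<in>{1..nv}. \<exists>l\<in>{1..nv}. j \<noteq> l \<and> [i j = i l] (mod int N)) \<or>
    length es = 8 \<and> (\<exists>j\<in>{1..nv}. \<exists>l\<in>{1..nv}. \<exists>p\<in>{1..nv}. \<exists>q\<in>{1..nv}.
      j \<noteq> l \<and> l \<noteq> q \<and> q \<noteq> p \<and> p \<noteq> j \<and> [i j - i l = i p - i q] (mod int N))"
proof -
  let ?n = "length es"
  obtain v e where w: "\<And>k. v (k + ?n) = v k" "\<And>k. e (k + ?n) = e k"
    "\<And>k. e k \<in> edges (tanner_graph (H2 N nv P))"
    "\<And>k. ends (tanner_graph (H2 N nv P)) (e k) = {v k, v (Suc k)}"
    "\<And>k. e k \<noteq> e (Suc k)"
    using tanner_cycle_walk[OF cyc] by blast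
  define blk where "blk k = fst (snd (e k)) div N + 1" for k
  have per: "blk (k + ?n) = blk k" for k by (simp add: blk_def w(2))
  note blk_range = blk_range[where v = v and e = e, OF w(3-5), folded blk_def]
  note double_step = double_step[where v = v and e = e, OF w(3-5), folded blk_def]
  obtain k t where t: "v k = Check t" "t < N" using reaches_upper_check[where v = v and e = e, OF w(3-5)] .
  have "4 dvd ?n" using period_multiple_of_4[where v = v and e = e, OF w(3-5) t w(1)] .
  moreover have "?n \<noteq> 0" using cyc by (simp add: is_cycle_def)
  ultimately have "?n = 4 \<or> ?n = 8" using le by (elim dvdE) auto
  then show ?thesis
  proof
    assume n: "?n = 4"
    obtain t' where t': "v (k + 4) = Check t'" "blk (k + 2) \<noteq> blk k"
      "[int t + i (blk k) = int t' + i (blk (k + 2))] (mod int N)"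
      using double_step[OF t] by metis
    have "t' = t" using t t'(1) w(1)[of k] n by simp
    with t'(3) have "[i (blk k) = i (blk (k + 2))] (mod int N)" by (simp add: cong_add_lcancel)
    with n t'(2) blk_range[of k] blk_range[of "k + 2"] show ?thesis by metis
  next
    assume n: "?n = 8"
    obtain t' where t': "v (k + 4) = Check t'" "t' < N" "blk (k + 2) \<noteq> blk k"
      "blk (k + 4) \<noteq> blk (k + 2)"
      "[int t + i (blk k) = int t' + i (blk (k + 2))] (mod int N)"
      using double_step[OF t] by metis
    obtain t'' where t'': "v (k + 4 + 4) = Check t''" "blk (k + 4 + 2) \<noteq> blk (k + 4)"
      "blk (k + 4 + 4) \<noteq> blk (k + 4 + 2)"
      "[int t' + i (blk (k + 4)) = int t'' + i (blk (k + 4 + 2))] (mod int N)"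
      using double_step[OF t'(1,2)] by metis
    have "t'' = t" using t t''(1) w(1)[of k] n by (simp add: add.commute)
    moreover have "blk (k + 4 + 4) = blk k" using per[of k] n by (simp add: add.commute)
    \<comment> \<open>Adding the congruences of the two double steps cancels both \<open>t\<close>
      and \<open>t'\<close>.\<close>
    moreover have "[i (blk k) - i (blk (k + 2)) = i (blk (k + 4 + 2)) - i (blk (k + 4))] (mod int N)"
      using cong_add[OF t'(5) t''(4)] \<open>t'' = t\<close>
      by (simp add: cong_iff_dvd_diff algebra_simps)
    ultimately show ?thesis
      using n t'(3,4) t''(2,3) blk_range[of k] blk_range[of "k + 2"] blk_range[of "k + 4"]
        blk_range[of "k + 4 + 2"] by metis
  qed
qed

section \<open>Explicit cycles of length 4 and 8\<close>

lemma column_index: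
  assumes "j \<in> {1..nv}" "t < N"
  shows "(j - 1) * N + t < nv * N" "((j - 1) * N + t) mod N = t" "((j - 1) * N + t) div N + 1 = j"
proof -
  have "(j - 1) * N + t < (j - 1) * N + N" using assms by simp
  also have "\<dots> = j * N" using assms by (cases j) auto
  also have "\<dots> \<le> nv * N" using assms by simp
  finally show "(j - 1) * N + t < nv * N" .
  show "((j - 1) * N + t) mod N = t" "((j - 1) * N + t) div N + 1 = j"
    using assms by auto
qed

lemma upper_edge:
  assumes "j \<in> {1..nv}" "t < N"
  shows "(t, (j - 1) * N + t, 0) \<in> edges (tanner_graph (H2 N nv P))"
  using assms column_index[OF assms] by (simp add: H2_edge_iff)

lemma lower_edge:
  assumes "j \<in> {1..nv}" "t < N" "b < N" "[int b = int t + i j] (mod int N)"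
  shows "(N + b, (j - 1) * N + t, 0) \<in> edges (tanner_graph (H2 N nv P))"
proof -
  have "[int (N + b) = int ((j - 1) * N + t) + i j] (mod int N)"
    using assms(4) by (simp add: cong_def mod_simps)
      (metis mod_mult_self3 add.assoc)
  then show ?thesis
    unfolding H2_edge_iff column_index(3)[OF assms(1,2)] using assms column_index[OF assms(1,2)] by simp
qed

text \<open>From the upper check 0, equal shifts lead through the two block columns to the same
  lower check.\<close>

lemma H2_4_cycle:
  assumes "j \<in> {1..nv}" "l \<in> {1..nv}" "j \<noteq> l" "[i j = i l] (mod int N)"
  shows "\<exists>vs es. is_cycle (tanner_graph (H2 N nv P)) vs es \<and> length es = 4"
proof -
  define b where "b = nat (i j mod int N)"
  have b: "int b = i j mod int N" "b < N" using N by (simp_all add: b_def nat_less_iff)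
  \<comment> \<open>The summand 0 keeps the form \<open>(j - 1) * N + t\<close> in which
    \<open>upper_edge\<close> and \<open>lower_edge\<close> are stated.\<close>
  define c where "c m = (m - 1) * N + 0" for m
  have N0: "0 < N" using N by simp
  have cong: "[int b = int 0 + i j] (mod int N)" "[int b = int 0 + i l] (mod int N)"
    using b assms(4) by (simp_all add: cong_def)
  have e: "(0, c j, 0) \<in> edges (tanner_graph (H2 N nv P))"
    "(0, c l, 0) \<in> edges (tanner_graph (H2 N nv P))"
    "(N + b, c j, 0) \<in> edges (tanner_graph (H2 N nv P))"
    "(N + b, c l, 0) \<in> edges (tanner_graph (H2 N nv P))"
    unfolding c_def
    by (rule upper_edge[OF assms(1) N0] upper_edge[OF assms(2) N0]
      lower_edge[OF assms(1) N0 b(2) cong(1)] lower_edge[OF assms(2) N0 b(2) cong(2)])+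
  have c: "c j \<noteq> c l" "c j < nv * N" "c l < nv * N"
    using column_index[OF assms(1) N0] column_index[OF assms(2) N0] assms(3)
    unfolding c_def by metis+
  have "is_cycle (tanner_graph (H2 N nv P))
      [Check 0, Variable (c j), Check (N + b), Variable (c l)]
      [(0, c j, 0), (N + b, c j, 0), (N + b, c l, 0), (0, c l, 0)]"
    unfolding is_cycle_def using e c b(2) N
    by (auto simp: tanner_ends H2_vert_iff less_Suc_eq)
  then show ?thesis by fastforce
qed

text \<open>The cycle leaves the upper check 0 through block \<open>j\<close>, rises through
  \<open>l\<close> to the upper check \<open>t\<close>, descends through \<open>q\<close> and
  returns through \<open>p\<close>. The two incongruences keep the two upper and the two lower
  checks apart.\<close>

lemma H2_8_cycle:
  assumes J: "j \<in> {1..nv}" "l \<in> {1..nv}" "p \<in> {1..nv}" "q \<in> {1..nv}"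
    and neq: "\<not> [i j = i l] (mod int N)" "\<not> [i j = i p] (mod int N)"
    and diff: "[i j - i l = i p - i q] (mod int N)"
  shows "\<exists>vs es. is_cycle (tanner_graph (H2 N nv P)) vs es \<and> length es = 8"
proof -
  define t where "t = nat ((i j - i l) mod int N)"
  have t: "int t = (i j - i l) mod int N" "t < N" using N by (simp_all add: t_def nat_less_iff)
  define b where "b m = nat (i m mod int N)" for m
  have b: "int (b m) = i m mod int N" "b m < N" for m using N by (simp_all add: b_def nat_less_iff)
  define c where "c m = (m - 1) * N + 0" for m
  define d where "d m = (m - 1) * N + t" for m
  have cong: "[int (b j) = int 0 + i j] (mod int N)" "[int (b p) = int 0 + i p] (mod int N)"
    using b by (simp_all add: cong_def)
  have tl: "[int t + i l = i j] (mod int N)" unfolding t cong_def by (simp add: mod_simps)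
  \<comment> \<open>Equality of the differences makes \<open>t\<close> reachable through
    \<open>p\<close> and \<open>q\<close> as well, which closes the cycle.\<close>
  have "[int t = i p - i q] (mod int N)" using t diff by (simp add: cong_def)
  then have tq: "[int t + i q = i p] (mod int N)"
    by (simp add: cong_iff_dvd_diff algebra_simps)
  have cong': "[int (b j) = int t + i l] (mod int N)" "[int (b p) = int t + i q] (mod int N)"
    using cong tl tq by (metis cong_sym cong_trans add_0 of_nat_0)+
  have N0: "0 < N" using N by simp
  have e: "(0, c j, 0) \<in> edges (tanner_graph (H2 N nv P))"
    "(0, c p, 0) \<in> edges (tanner_graph (H2 N nv P))"
    "(t, d l, 0) \<in> edges (tanner_graph (H2 N nv P))"
    "(t, d q, 0) \<in> edges (tanner_graph (H2 N nv P))"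
    "(N + b j, c j, 0) \<in> edges (tanner_graph (H2 N nv P))"
    "(N + b p, c p, 0) \<in> edges (tanner_graph (H2 N nv P))"
    "(N + b j, d l, 0) \<in> edges (tanner_graph (H2 N nv P))"
    "(N + b p, d q, 0) \<in> edges (tanner_graph (H2 N nv P))"
    unfolding c_def d_def
    by (rule upper_edge[OF J(1) N0] upper_edge[OF J(3) N0] upper_edge[OF J(2) t(2)]
      upper_edge[OF J(4) t(2)] lower_edge[OF J(1) N0 b(2) cong(1)]
      lower_edge[OF J(3) N0 b(2) cong(2)] lower_edge[OF J(2) t(2) b(2) cong'(1)]
      lower_edge[OF J(4) t(2) b(2) cong'(2)])+
  have t0: "t \<noteq> 0" using neq(1) tl by (metis add_0 cong_sym of_nat_0)
  have bb: "b j \<noteq> b p" using neq(2) b(1) by (metis cong_def)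
  have cm: "c j < nv * N" "c p < nv * N" "d l < nv * N" "d q < nv * N"
    using column_index(1) J N0 t(2) unfolding c_def d_def by blast+
  have mods: "c j mod N = 0" "c p mod N = 0" "d l mod N = t" "d q mod N = t"
    using column_index(2) J N0 t(2) unfolding c_def d_def by blast+
  \<comment> \<open>Columns \<open>c\<close> have remainder 0 and columns \<open>d\<close> have
    remainder \<open>t\<close>, which is not 0.\<close>
  have cd: "c j \<noteq> d l" "c j \<noteq> d q" "c p \<noteq> d l" "c p \<noteq> d q" using mods t0 by metis+
  have jp: "j \<noteq> p" using bb by blast
  \<comment> \<open>If \<open>l = q\<close>, then \<open>i j\<close> and \<open>i p\<close> would
    both be congruent to \<open>t + i l\<close>.\<close>
  have lq: "l \<noteq> q" using tl tq neq(2) by (metis cong_sym cong_trans)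
  have same: "c j \<noteq> c p" "d l \<noteq> d q"
    using jp lq column_index(3) J N0 t(2) unfolding c_def d_def by metis+
  have "is_cycle (tanner_graph (H2 N nv P))
      [Check 0, Variable (c j), Check (N + b j), Variable (d l),
       Check t, Variable (d q), Check (N + b p), Variable (c p)]
      [(0, c j, 0), (N + b j, c j, 0), (N + b j, d l, 0), (t, d l, 0),
       (t, d q, 0), (N + b p, d q, 0), (N + b p, c p, 0), (0, c p, 0)]"
    unfolding is_cycle_def using e cm cd same t0 bb N0 t(2) b(2)[of j] b(2)[of p]
    by (auto simp: tanner_ends H2_vert_iff less_Suc_eq)
  then show ?thesis by fastforce
qed

section \<open>The girth criteria for \<open>H2\<close>\<close>

lemma H2_girth_4: "girth (H2 N nv P) > 4 \<longleftrightarrow> maximal_size N {1..nv} i"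
proof -
  have "girth (H2 N nv P) > 4 \<longleftrightarrow>
      (\<forall>vs es. is_cycle (tanner_graph (H2 N nv P)) vs es \<longrightarrow> length es > 4)"
    using graph_girth_greater_iff[of 4] by (simp add: girth_def numeral_eq_enat)
  also have "\<dots> \<longleftrightarrow> maximal_size N {1..nv} i"
  proof
    assume "\<forall>vs es. is_cycle (tanner_graph (H2 N nv P)) vs es \<longrightarrow> length es > 4"
    then show "maximal_size N {1..nv} i"
      unfolding maximal_size_def using H2_4_cycle by (metis less_irrefl)
  next
    assume max: "maximal_size N {1..nv} i"
    show "\<forall>vs es. is_cycle (tanner_graph (H2 N nv P)) vs es \<longrightarrow> length es > 4"
    proof (intro allI impI, rule ccontr)
      fix vs es assume "is_cycle (tanner_graph (H2 N nv P)) vs es" "\<not> length es > 4"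
      with H2_short_cycle[of vs es] max show False
        unfolding maximal_size_def by fastforce
    qed
  qed
  finally show ?thesis .
qed

lemma H2_girth_8:
  "girth (H2 N nv P) > 8 \<longleftrightarrow>
   maximal_size N {(j, l). j \<in> {1..nv} \<and> l \<in> {1..nv} \<and> j \<noteq> l} (\<lambda>(j, l). i j - i l)"
  (is "_ \<longleftrightarrow> ?max")
proof -
  have "girth (H2 N nv P) > 8 \<longleftrightarrow>
      (\<forall>vs es. is_cycle (tanner_graph (H2 N nv P)) vs es \<longrightarrow> length es > 8)"
    using graph_girth_greater_iff[of 8] by (simp add: girth_def numeral_eq_enat)
  also have "\<dots> \<longleftrightarrow> ?max"
  proof
    assume long: "\<forall>vs es. is_cycle (tanner_graph (H2 N nv P)) vs es \<longrightarrow> length es > 8"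
    \<comment> \<open>Excluding 4-cycles supplies the incongruences that the construction of an
      8-cycle requires.\<close>
    have inj: "\<not> [i j = i l] (mod int N)" if "j \<in> {1..nv}" "l \<in> {1..nv}" "j \<noteq> l" for j l
      using H2_4_cycle[OF that] long by fastforce
    have "False" if J: "j \<in> {1..nv}" "l \<in> {1..nv}" "p \<in> {1..nv}" "q \<in> {1..nv}"
      and neq: "j \<noteq> l" "(j, l) \<noteq> (p, q)"
      and diff: "[i j - i l = i p - i q] (mod int N)" for j l p q
    proof (cases "j = p")
      case True
      \<comment> \<open>A common first index cancels, and \<open>l \<noteq> q\<close> then
        contradicts \<open>inj\<close>.\<close>
      then have "[i l = i q] (mod int N)"
        using diff cong_diff[OF cong_refl[of "i j"] diff] by simp
      with inj J neq(2) True show False by blast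
    next
      case False
      with H2_8_cycle[OF J inj[OF J(1,2) neq(1)] inj[OF J(1,3)] diff] long show False by fastforce
    qed
    then show ?max unfolding maximal_size_def by auto
  next
    assume max: ?max
    have diffs: "j = p \<and> l = q"
      if "j \<in> {1..nv}" "l \<in> {1..nv}" "p \<in> {1..nv}" "q \<in> {1..nv}" "j \<noteq> l" "p \<noteq> q"
        "[i j - i l = i p - i q] (mod int N)" for j l p q
      using max that unfolding maximal_size_def by fastforce
    show "\<forall>vs es. is_cycle (tanner_graph (H2 N nv P)) vs es \<longrightarrow> length es > 8"
    proof (intro allI impI, rule ccontr)
      fix vs es assume "is_cycle (tanner_graph (H2 N nv P)) vs es" "\<not> length es > 8"
      then consider (four) j l where "j \<in> {1..nv}" "l \<in> {1..nv}" "j \<noteq> l" "[i j = i l] (mod int N)"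
        | (eight) j l p q where "j \<in> {1..nv}" "l \<in> {1..nv}" "p \<in> {1..nv}" "q \<in> {1..nv}"
          "j \<noteq> l" "q \<noteq> p" "p \<noteq> j" "[i j - i l = i p - i q] (mod int N)"
        using H2_short_cycle[of vs es] by (metis not_less)
      then show False
      proof cases
        case four
        \<comment> \<open>A 4-cycle also violates maximality: the differences of the distinct pairs
          \<open>(j, l)\<close> and \<open>(l, j)\<close> both vanish modulo
          \<open>N\<close>.\<close>
        then have "[i j - i l = i l - i j] (mod int N)" by (intro cong_diff) (auto dest: cong_sym)
        with four diffs[of j l l j] show False by blast
      next
        case eight
        with diffs[of j l p q] show False by blast
      qed
    qed
  qed
  finally show ?thesis .
qed

end

theorem theorem22:
  fixes nv N :: nat and i :: "nat \<Rightarrow> int" and P :: "nat \<Rightarrow> nat mat"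
  assumes "nv \<ge> 1" and "N \<ge> 1"
    and "[i 1 = 0] (mod int N)"
    and "\<And>j. j \<in> {1..nv} \<Longrightarrow> P j = circ N (i j)"
  shows "(girth (H2 N nv P) > 4 \<longleftrightarrow> girth (C21 N nv P) > 2) \<and>
         (girth (C21 N nv P) > 2 \<longleftrightarrow> maximal_size N {1..nv} i) \<and>
         (girth (H2 N nv P) > 8 \<longleftrightarrow>
            maximal_size N {(j, l). j \<in> {1..nv} \<and> l \<in> {1..nv} \<and> j \<noteq> l} (\<lambda>(j, l). i j - i l))"
  using C21_girth[where i = i and P = P, OF assms(2,4)] H2_girth_4[where i = i and P = P, OF assms(2,4)]
    H2_girth_8[where i = i and P = P, OF assms(2,4)]
  by blast

end
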